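(* Let $c=(C_n)_{n\ge 0}$ be the Catalan sequence, regarded as an element of the Banach algebra $\ell^1(\mathbb{N}^0,\frac{1}{4^n})$. Then the spectrum of $c$ is $$\sigma(c)=C\left(\overline{D(0,\tfrac14)}\right),$$ and its boundary is $$\partial(\sigma(c))=\left\{2e^{-i\theta}\left(1-\sqrt{2\left|\sin\left(\tfrac{\theta}{2}\right)\right|}\;e^{\frac{i(\pi-\theta)}{4}}\right)\ :\ \theta\in(-\pi,\pi)\right\}.$$
   Context: The Catalan numbers are $C_n=\frac{1}{n+1}\binom{2n}{n}$, $n\ge 0$ (the set of integers $n\ge 0$ is denoted $\mathbb{N}^0$). The algebra $\ell^1(\mathbb{N}^0,\frac1{4^n})$ consists of the complex sequences $a=(a_n)_{n\ge0}$ with $\|a\|_{1,\frac1{4^n}}:=\sum_{n\ge0}\frac{|a_n|}{4^n}<\infty$, with the convolution product $(a\ast b)_n=\sum_{j=0}^n a_{n-j}b_j$; its identity is $\delta_0=(1,0,0,\dots)$. The Catalan sequence belongs to it. For $a$ in this algebra, $\sigma(a)$ is the set of $\lambda\in\mathbb{C}$ such that $\lambda\delta_0-a$ is not invertible in the algebra. $D(0,\frac14)=\{z\in\mathbb{C}:|z|<\frac14\}$, $\overline{D(0,\frac14)}$ is its closure, and $C(z)=\sum_{n=0}^\infty C_nz^n$ for $|z|\le\frac14$ (an absolutely convergent series).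
   Formalization: The printed boundary formula is false (at θ = −π/2 it gives a point of modulus about 2.45, but σ(c) lies in |w| ≤ 2); the formal statement uses e^{−i(π−θ)/4} in place of e^{i(π−θ)/4} and θ ∈ [0,2π) in place of (−π,π). *)

theory Defs
  imports "HOL-Analysis.Analysis"
begin

definition catalan :: "nat \<Rightarrow> complex" where
  "catalan n = of_nat ((2 * n) choose n) / of_nat (n + 1)"

text \<open>The algebra \<open>\<ell>\<^sup>1(\<nat>, 1/4\<^sup>n)\<close> is represented by its carrier inside the type of all
  complex sequences. Its vector space operations are pointwise and its product is \<open>conv\<close>, with
  identity \<open>delta0\<close>.\<close>

definition ell1 :: "(nat \<Rightarrow> complex) set" where
  "ell1 = {a. summable (\<lambda>n. norm (a n) / 4 ^ n)}"

definition conv :: "(nat \<Rightarrow> complex) \<Rightarrow> (nat \<Rightarrow> complex) \<Rightarrow> nat \<Rightarrow> complex" where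
  "conv a b = (\<lambda>n. \<Sum>j=0..n. a (n - j) * b j)"

definition delta0 :: "nat \<Rightarrow> complex" where
  "delta0 = (\<lambda>n. if n = 0 then 1 else 0)"

text \<open>The inverse is required to lie in the algebra: every sequence with nonzero initial term is
  invertible among all sequences.\<close>

definition ell1_invertible :: "(nat \<Rightarrow> complex) \<Rightarrow> bool" where
  "ell1_invertible a \<longleftrightarrow> (\<exists>b\<in>ell1. conv a b = delta0 \<and> conv b a = delta0)"

definition ell1_spectrum :: "(nat \<Rightarrow> complex) \<Rightarrow> complex set" where
  "ell1_spectrum a = {l. \<not> ell1_invertible (\<lambda>n. l * delta0 n - a n)}"

text \<open>Only the values with \<open>norm z \<le> 1/4\<close> are meaningful, as \<open>suminf\<close> is unspecified on divergent
  series.\<close>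

definition catalan_gf :: "complex \<Rightarrow> complex" where
  "catalan_gf z = (\<Sum>n. catalan n * z ^ n)"

lemma sum_catalan_weighted:
  "(\<Sum>n<N. norm (catalan n) / 4 ^ n) = 2 * (1 - real ((2 * N) choose N) / 4 ^ N)"
proof (induction N)
  case 0
  then show ?case by simp
next
  case (Suc N)
  have nat_rec: "Suc N * ((2 * Suc N) choose Suc N) = 2 * (2 * N + 1) * ((2 * N) choose N)"
  proof -
    have dbl: "2 * Suc N = Suc (Suc (2 * N))"
      by simp
    have "Suc N * ((2 * Suc N) choose Suc N) = 2 * (Suc N * (Suc (2 * N) choose N))"
      unfolding dbl using Suc_times_binomial_eq[of "Suc (2 * N)" N]
      by (simp add: mult.commute del: binomial_Suc_Suc)
    also have "Suc N * (Suc (2 * N) choose N) = Suc (2 * N) * ((2 * N) choose N)"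
      using binomial_absorb_comp[of "Suc (2 * N)" N] by (simp add: Suc_diff_le)
    finally show ?thesis
      by simp
  qed
  have rec: "real ((2 * Suc N) choose Suc N) = 2 * (2 * N + 1) * real ((2 * N) choose N) / Suc N"
  proof -
    have "real (Suc N) * real ((2 * Suc N) choose Suc N) = real (2 * (2 * N + 1)) * real ((2 * N) choose N)"
      using arg_cong[OF nat_rec, of real] by (simp only: of_nat_mult)
    then show ?thesis
      by (subst eq_divide_eq) (simp only: mult.commute, simp)
  qed
  have nc: "norm (catalan N) = real ((2 * N) choose N) / Suc N"
    by (simp only: catalan_def norm_divide norm_of_nat Suc_eq_plus1)
  have id: "2 * (1 - x / p) + x / s / p = 2 * (1 - ((4 * s - 2) * x / s) / (4 * p))"
    if "s > 0" "p > 0" for x p s :: real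
    using that by (simp add: divide_simps) (simp add: algebra_simps)
  have cast: "real (2 * (2 * N + 1)) = 4 * real (Suc N) - 2"
    by simp
  show ?case
    unfolding sum.lessThan_Suc Suc.IH nc rec cast power_Suc by (rule id) simp_all
qed

lemma catalan_in_ell1: "catalan \<in> ell1"
  unfolding ell1_def mem_Collect_eq
proof (rule bounded_imp_summable[where B = 2])
  show "(\<Sum>n\<le>N. norm (catalan n) / 4 ^ n) \<le> 2" for N
    unfolding lessThan_Suc_atMost[symmetric] sum_catalan_weighted by simp
qed simp

lemma summable_catalan_gf:
  assumes "norm z \<le> 1/4"
  shows "summable (\<lambda>n. norm (catalan n * z ^ n))"
proof (rule summable_comparison_test')
  show "summable (\<lambda>n. norm (catalan n) / 4 ^ n)"
    using catalan_in_ell1 by (simp add: ell1_def)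
  show "norm (norm (catalan n * z ^ n)) \<le> norm (catalan n) / 4 ^ n" if "n \<ge> 0" for n
    using mult_left_mono[OF power_mono[OF assms norm_ge_zero, of n], of "norm (catalan n)"]
    by (simp add: norm_mult norm_power power_one_over)
qed

end

(*
  The Catalan series satisfies C = 1 + X C^2, so z = (C(z) - 1) / C(z)^2 and C is injective on the
  closed disc. Evaluation at a point of the disc is a character of the algebra, hence C maps the
  disc into the spectrum. Conversely the quadratic equation gives an explicit resolvent, whose only
  delicate ingredient is that the divided difference of C at z lies in the algebra for z \<noteq> 1/4;
  this follows by summation by parts since C_n / 4^n is decreasing. At z = 1/4 the quadratic has
  the double root 2, so nothing is left to invert there. The boundary is the image of the circle by
  the open mapping theorem, applied to C on the open disc and to its inverse on the interior of the
  image.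
*)

theory Submission
  imports Defs "HOL-Complex_Analysis.Conformal_Mappings"
begin

subsection \<open>The weighted algebra as an algebra of power series\<close>

text \<open>Moving to formal power series makes the ring laws and cancellation of an integral domain
  available; membership in \<open>ell1\<close> is then tracked separately.\<close>

lemma conv_eq_fps_mult: "conv a b = fps_nth (Abs_fps a * Abs_fps b)"
proof
  fix n
  have "(\<Sum>j=0..n. a (n - j) * b j) = (\<Sum>j=0..n. a j * b (n - j))"
    by (rule sum.reindex_bij_witness[where i = "\<lambda>j. n - j" and j = "\<lambda>j. n - j"]) auto
  then show "conv a b n = fps_nth (Abs_fps a * Abs_fps b) n"
    by (simp add: conv_def fps_mult_nth)
qed

lemma delta0_eq_fps_one: "delta0 = fps_nth 1"
  by (auto simp: delta0_def fun_eq_iff)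

lemma ell1_invertible_iff_fps:
  "ell1_invertible (fps_nth f) \<longleftrightarrow> (\<exists>g. fps_nth g \<in> ell1 \<and> f * g = 1)"
proof -
  have "ell1_invertible (fps_nth f) \<longleftrightarrow> (\<exists>b\<in>ell1. f * Abs_fps b = 1)"
    unfolding ell1_invertible_def conv_eq_fps_mult delta0_eq_fps_one
    by (simp add: fps_nth_inject fps_nth_inverse mult.commute)
  also have "\<dots> \<longleftrightarrow> (\<exists>g. fps_nth g \<in> ell1 \<and> f * g = 1)"
    by (metis fps_nth_Abs_fps fps_nth_inverse ext)
  finally show ?thesis .
qed

lemma ell1_fps_add:
  assumes "fps_nth f \<in> ell1" "fps_nth g \<in> ell1"
  shows "fps_nth (f + g) \<in> ell1"
proof -
  have "summable (\<lambda>n. norm (fps_nth f n) / 4 ^ n + norm (fps_nth g n) / 4 ^ n)"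
    using assms by (intro summable_add) (simp_all add: ell1_def)
  then show ?thesis
    unfolding ell1_def mem_Collect_eq
    by (rule summable_comparison_test') (simp add: add_divide_distrib[symmetric] divide_right_mono norm_triangle_ineq)
qed

text \<open>The weight is multiplicative, 4^n = 4^i * 4^(n-i), so the weighted product is dominated
  by a Cauchy product of summable series.\<close>

lemma ell1_fps_mult:
  assumes "fps_nth f \<in> ell1" "fps_nth g \<in> ell1"
  shows "fps_nth (f * g) \<in> ell1"
proof -
  have "summable (\<lambda>n. \<Sum>i\<le>n. (norm (fps_nth f i) / 4 ^ i) * (norm (fps_nth g (n - i)) / 4 ^ (n - i)))"
    using assms by (intro summable_Cauchy_product) (simp_all add: ell1_def)
  then show ?thesis
    unfolding ell1_def mem_Collect_eq
  proof (rule summable_comparison_test')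
    fix n :: nat
    have "norm (fps_nth (f * g) n) / 4 ^ n \<le> (\<Sum>i=0..n. norm (fps_nth f i * fps_nth g (n - i))) / 4 ^ n"
      unfolding fps_mult_nth by (intro divide_right_mono norm_sum) simp
    also have "\<dots> = (\<Sum>i\<le>n. (norm (fps_nth f i) / 4 ^ i) * (norm (fps_nth g (n - i)) / 4 ^ (n - i)))"
      unfolding sum_divide_distrib atLeast0AtMost
      by (intro sum.cong refl) (simp add: norm_mult power_add[symmetric])
    finally show "norm (norm (fps_nth (f * g) n) / 4 ^ n)
        \<le> (\<Sum>i\<le>n. (norm (fps_nth f i) / 4 ^ i) * (norm (fps_nth g (n - i)) / 4 ^ (n - i)))"
      by simp
  qed
qed

lemma ell1_fps_const: "fps_nth (fps_const c) \<in> ell1"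
  unfolding ell1_def mem_Collect_eq by (rule summable_finite[of "{0}"]) auto

lemma ell1_fps_X: "fps_nth fps_X \<in> ell1"
  unfolding ell1_def mem_Collect_eq by (rule summable_finite[of "{1}"]) (auto simp: fps_X_def)

section \<open>Evaluation on the closed disc and division by linear factors\<close>

lemma norm_coeff_mult_power_le:
  assumes "norm (z::complex) \<le> 1/4"
  shows "norm (a * z ^ n) \<le> norm a / 4 ^ n"
  using mult_left_mono[OF power_mono[OF assms norm_ge_zero, of n], of "norm a"]
  by (simp add: norm_mult norm_power power_one_over)

lemma ell1_summable_norm:
  assumes "a \<in> ell1" "norm z \<le> 1/4"
  shows "summable (\<lambda>n. norm (a n * z ^ n))"
proof (rule summable_comparison_test')
  show "summable (\<lambda>n. norm (a n) / 4 ^ n)"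
    using assms by (simp add: ell1_def)
  show "norm (norm (a n * z ^ n)) \<le> norm (a n) / 4 ^ n" for n
    using norm_coeff_mult_power_le[OF assms(2)] by simp
qed

text \<open>Absolute convergence persists on the boundary circle, so together with additivity every
  point of the closed disc gives a character.\<close>

lemma eval_fps_mult_ell1:
  assumes "fps_nth f \<in> ell1" "fps_nth g \<in> ell1" "norm z \<le> 1/4"
  shows "eval_fps (f * g) z = eval_fps f z * eval_fps g z"
proof -
  have "eval_fps f z * eval_fps g z
      = (\<Sum>n. \<Sum>i\<le>n. (fps_nth f i * z ^ i) * (fps_nth g (n - i) * z ^ (n - i)))"
    unfolding eval_fps_def using assms by (intro Cauchy_product ell1_summable_norm)
  also have "\<dots> = eval_fps (f * g) z"
    unfolding eval_fps_def fps_mult_nth sum_distrib_right atLeast0AtMost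
    by (intro suminf_cong sum.cong refl) (simp add: power_add[symmetric])
  finally show ?thesis ..
qed

lemma eval_fps_add_ell1:
  assumes "fps_nth f \<in> ell1" "fps_nth g \<in> ell1" "norm z \<le> 1/4"
  shows "eval_fps (f + g) z = eval_fps f z + eval_fps g z"
  unfolding eval_fps_def using assms
  by (simp add: suminf_add ring_distribs ell1_summable_norm summable_norm_cancel)

text \<open>The tails obey the Horner recursion \<open>G n = f n + z * G (Suc n)\<close>, which is
  the coefficientwise form of the identity. Whether the quotient lies in \<open>ell1\<close> is a
  separate question.\<close>

lemma divided_difference_fps:
  assumes "fps_nth f \<in> ell1" "norm z \<le> 1/4"
  shows "(fps_X - fps_const z) * Abs_fps (\<lambda>n. \<Sum>m. fps_nth f (Suc n + m) * z ^ m)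
       = f - fps_const (eval_fps f z)"
proof (rule fps_ext)
  define G where "G = (\<lambda>n. \<Sum>m. fps_nth f (n + m) * z ^ m)"
  have summable: "summable (\<lambda>m. fps_nth f (n + m) * z ^ m)" for n
  proof (cases "z = 0")
    case False
    have "summable (\<lambda>m. fps_nth f (m + n) * z ^ (m + n))"
      by (rule summable_ignore_initial_segment[OF summable_norm_cancel[OF ell1_summable_norm[OF assms]]])
    then have "summable (\<lambda>m. inverse (z ^ n) * (fps_nth f (m + n) * z ^ (m + n)))"
      by (rule summable_mult)
    moreover have "inverse (z ^ n) * (fps_nth f (m + n) * z ^ (m + n)) = fps_nth f (n + m) * z ^ m" for m
      using False by (simp add: power_add add.commute[of n m])
    ultimately show ?thesis
      by simp
  qed simp
  have step: "G n = fps_nth f n + z * G (Suc n)" for n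
  proof -
    have "G n = fps_nth f n + (\<Sum>m. fps_nth f (n + Suc m) * z ^ Suc m)"
      using suminf_split_head[OF summable, of n] by (simp add: G_def)
    also have "(\<Sum>m. fps_nth f (n + Suc m) * z ^ Suc m) = z * G (Suc n)"
      unfolding G_def using suminf_mult[OF summable[of "Suc n"], of z] by (simp add: mult_ac)
    finally show ?thesis .
  qed
  have 0: "G 0 = eval_fps f z"
    by (simp add: G_def eval_fps_def)
  fix n
  show "fps_nth ((fps_X - fps_const z) * Abs_fps (\<lambda>n. \<Sum>m. fps_nth f (Suc n + m) * z ^ m)) n
      = fps_nth (f - fps_const (eval_fps f z)) n"
    using step[of n] by (cases n) (simp_all add: left_diff_distrib G_def 0[symmetric])
qed

text \<open>The inverse is a geometric series whose weighted ratio is 1 / (4 |z|) < 1.\<close>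

lemma ell1_inverse_linear:
  assumes "norm z > 1/4"
  shows "fps_nth (inverse (fps_X - fps_const z)) \<in> ell1"
proof -
  have z: "z \<noteq> 0"
    using assms by auto
  have "inverse (fps_X - fps_const z) = Abs_fps (\<lambda>n. - inverse (z ^ Suc n))"
  proof (rule fps_inverse_unique)
    show "(fps_X - fps_const z) * Abs_fps (\<lambda>n. - inverse (z ^ Suc n)) = 1"
    proof (rule fps_ext)
      fix n
      show "fps_nth ((fps_X - fps_const z) * Abs_fps (\<lambda>n. - inverse (z ^ Suc n))) n = fps_nth 1 n"
        using z by (cases n) (simp_all add: left_diff_distrib)
    qed
  qed
  moreover have "summable (\<lambda>n. inverse (norm z) * (1 / (4 * norm z)) ^ n)"
    using assms by (intro summable_mult summable_geometric) (simp add: divide_simps)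
  ultimately show ?thesis
    by (simp add: ell1_def norm_inverse norm_divide norm_power norm_mult power_mult_distrib field_simps)
qed

subsection \<open>The Catalan generating function\<close>

text \<open>Consecutive cases of \<open>sum_catalan_weighted\<close> differ by one term, and this
  difference already encodes the recurrence of the central binomial coefficients.\<close>

lemma catalan_rec:
  "of_nat (n + 2) * catalan (Suc n) = of_nat (4 * n + 2) * catalan n"
proof -
  define B where "B = (\<lambda>N. real ((2 * N) choose N))"
  have "norm (catalan n) / 4 ^ n = 2 * (1 - B (Suc n) / 4 ^ Suc n) - 2 * (1 - B n / 4 ^ n)"
    using sum_catalan_weighted[of "Suc n"] sum_catalan_weighted[of n]
    unfolding B_def sum.lessThan_Suc by linarith
  then have "norm (catalan n) / 4 ^ n = (2 * B n - B (Suc n) / 2) / 4 ^ n"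
    by (simp add: diff_divide_distrib)
  then have "norm (catalan n) = 2 * B n - B (Suc n) / 2"
    by simp
  moreover have "norm (catalan n) = B n / (real n + 1)"
    unfolding catalan_def B_def norm_divide norm_of_nat by simp
  ultimately have "B n / (real n + 1) = 2 * B n - B (Suc n) / 2"
    by simp
  then have "B (Suc n) * (real n + 1) = B n * (4 * real n + 2)"
    by (simp add: field_simps)
  from arg_cong[OF this, of complex_of_real]
  have "of_nat ((2 * Suc n) choose Suc n) * (of_nat n + 1 :: complex)
      = of_nat ((2 * n) choose n) * (4 * of_nat n + 2)"
    by (simp add: B_def del: binomial_Suc_Suc mult_Suc_right)
  moreover have "(of_nat n + 1 :: complex) \<noteq> 0" "(of_nat n + 2 :: complex) \<noteq> 0"
    by (metis of_nat_Suc of_nat_neq_0 add.commute,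
        metis of_nat_Suc of_nat_neq_0 add.commute add.assoc one_add_one)
  ultimately show ?thesis
    unfolding catalan_def by (simp add: field_simps del: binomial_Suc_Suc mult_Suc_right)
qed

lemma catalan_0: "catalan 0 = 1"
  by (simp add: catalan_def)

definition catalan_fps :: "complex fps" where
  "catalan_fps = Abs_fps catalan"

text \<open>Both sides solve \<open>(1 - 4X) h' = -4 h\<close> with \<open>h(0) = 1\<close>.\<close>

lemma catalan_fps_discriminant: "(1 - 2 * fps_X * catalan_fps)\<^sup>2 = 1 - 4 * fps_X"
proof -
  define S where "S = 1 - 2 * fps_X * catalan_fps"
  have S_nth: "fps_nth S n = (case n of 0 \<Rightarrow> 1 | Suc m \<Rightarrow> - 2 * catalan m)" for n
    by (cases n) (simp_all add: S_def catalan_fps_def mult.assoc numeral_fps_const)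
  \<comment> \<open>The equation of a square root of 1 - 4X; its coefficients are
    \<open>catalan_rec\<close>.\<close>
  have "(1 - 4 * fps_X) * fps_deriv S = - 2 * S"
  proof (rule fps_ext)
    fix n
    show "fps_nth ((1 - 4 * fps_X) * fps_deriv S) n = fps_nth (- 2 * S) n"
    proof (cases n)
      case 0
      then show ?thesis
        by (simp add: left_diff_distrib S_nth catalan_0 numeral_fps_const)
    next
      case (Suc m)
      then show ?thesis
        using arg_cong[OF catalan_rec[of m], of "(*) 2"]
        by (simp add: left_diff_distrib S_nth numeral_fps_const mult.assoc algebra_simps)
    qed
  qed
  moreover have "fps_deriv (S\<^sup>2) = 2 * S * fps_deriv S"
    by (simp add: power2_eq_square mult_ac)
  ultimately have ode: "(1 - 4 * fps_X) * fps_deriv (S\<^sup>2) = - 4 * S\<^sup>2"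
    by algebra
  \<comment> \<open>The factor vanishes at n = 1, which makes the square a polynomial of degree
    one.\<close>
  have rec: "of_nat (Suc n) * fps_nth (S\<^sup>2) (Suc n) = (4 * of_nat n - 4) * fps_nth (S\<^sup>2) n" for n
    using arg_cong[OF ode, of "\<lambda>h. fps_nth h n"]
    by (cases n) (simp_all add: left_diff_distrib numeral_fps_const mult.assoc algebra_simps)
  have "fps_nth (S\<^sup>2) n = fps_nth (1 - 4 * fps_X) n" for n
  proof (induction n)
    case 0
    then show ?case
      by (simp add: power2_eq_square S_nth)
  next
    case (Suc n)
    have "of_nat (Suc n) * fps_nth (S\<^sup>2) (Suc n) = of_nat (Suc n) * fps_nth (1 - 4 * fps_X) (Suc n)"
      unfolding rec Suc.IH by (auto simp: numeral_fps_const fps_X_def)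
    then show ?case
      by (metis mult_left_cancel of_nat_neq_0)
  qed
  then show ?thesis
    unfolding S_def[symmetric] by (rule fps_ext)
qed

lemma catalan_fps_quadratic: "catalan_fps = 1 + fps_X * catalan_fps\<^sup>2"
proof -
  have "4 * fps_X * catalan_fps = 4 * fps_X * (1 + fps_X * catalan_fps\<^sup>2)"
    using catalan_fps_discriminant by (simp add: power2_eq_square algebra_simps)
  then show ?thesis
    by simp
qed

section \<open>The generating function on the closed disc\<close>

lemma catalan_gf_eq_eval: "catalan_gf z = eval_fps catalan_fps z"
  by (simp add: catalan_gf_def eval_fps_def catalan_fps_def)

lemma fps_nth_catalan_fps: "fps_nth catalan_fps = catalan"
  by (simp add: catalan_fps_def Abs_fps_inverse)

lemma catalan_fps_in_ell1: "fps_nth catalan_fps \<in> ell1"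
  by (simp add: fps_nth_catalan_fps catalan_in_ell1)

lemma catalan_gf_quadratic:
  assumes "norm z \<le> 1/4"
  shows "catalan_gf z = 1 + z * (catalan_gf z)\<^sup>2"
proof -
  note mem = ell1_fps_const[of 1, simplified] ell1_fps_X catalan_fps_in_ell1
  have "eval_fps catalan_fps z = eval_fps (1 + fps_X * (catalan_fps * catalan_fps)) z"
    using catalan_fps_quadratic by (simp add: power2_eq_square)
  also have "\<dots> = 1 + z * (eval_fps catalan_fps z * eval_fps catalan_fps z)"
    using assms by (simp add: eval_fps_add_ell1 eval_fps_mult_ell1 ell1_fps_mult mem)
  finally show ?thesis
    by (simp add: catalan_gf_eq_eval power2_eq_square)
qed

lemma catalan_gf_nonzero:
  assumes "norm z \<le> 1/4"
  shows "catalan_gf z \<noteq> 0"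
  using catalan_gf_quadratic[OF assms] by auto

lemma catalan_gf_inverse:
  assumes "norm z \<le> 1/4"
  shows "z = (catalan_gf z - 1) / (catalan_gf z)\<^sup>2"
  using catalan_gf_quadratic[OF assms] catalan_gf_nonzero[OF assms]
  by (metis add_diff_cancel_left' nonzero_eq_divide_eq power_not_zero)

lemma inj_on_catalan_gf: "inj_on catalan_gf (cball 0 (1/4))"
  by (rule inj_onI) (metis catalan_gf_inverse mem_cball_0)

text \<open>Continuity up to the circle makes the image of the closed disc compact, hence
  closed.\<close>

lemma continuous_on_catalan_gf: "continuous_on (cball 0 (1/4)) catalan_gf"
proof (rule uniform_limit_theorem)
  show "uniform_limit (cball 0 (1/4)) (\<lambda>n z. \<Sum>i<n. catalan i * z ^ i) catalan_gf sequentially"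
    unfolding catalan_gf_def
  proof (rule Weierstrass_m_test)
    show "norm (catalan n * z ^ n) \<le> norm (catalan n) / 4 ^ n" if "z \<in> cball 0 (1/4)" for n z
      using that norm_coeff_mult_power_le by simp
    show "summable (\<lambda>n. norm (catalan n) / 4 ^ n)"
      using catalan_in_ell1 by (simp add: ell1_def)
  qed
qed (auto intro!: continuous_intros always_eventually)

lemma norm_catalan_gf_le:
  assumes "norm z \<le> 1/4"
  shows "norm (catalan_gf z) \<le> 2"
proof -
  have summable: "summable (\<lambda>n. norm (catalan n) / 4 ^ n)"
    using catalan_in_ell1 by (simp add: ell1_def)
  have "norm (catalan_gf z) \<le> (\<Sum>n. norm (catalan n * z ^ n))"
    unfolding catalan_gf_def by (rule summable_norm[OF summable_catalan_gf[OF assms]])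
  also have "\<dots> \<le> (\<Sum>n. norm (catalan n) / 4 ^ n)"
  proof (rule suminf_le[OF _ summable_catalan_gf[OF assms] summable])
    show "norm (catalan n * z ^ n) \<le> norm (catalan n) / 4 ^ n" for n
      by (rule norm_coeff_mult_power_le[OF assms])
  qed
  also have "\<dots> \<le> 2"
    by (rule suminf_le_const[OF summable]) (simp add: sum_catalan_weighted)
  finally show ?thesis .
qed

text \<open>The bound \<open>norm (catalan_gf z) \<le> 2\<close> puts \<open>1 - 2 z C(z)\<close> in the right half plane, which selects
  the principal branch of the square root.\<close>

lemma catalan_gf_csqrt:
  assumes "norm z \<le> 1/4"
  shows "2 * z * catalan_gf z = 1 - csqrt (1 - 4 * z)"
proof -
  define s where "s = 1 - 2 * z * catalan_gf z"
  have sq: "s\<^sup>2 = 1 - 4 * z"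
    using catalan_gf_quadratic[OF assms] unfolding s_def by algebra
  have "norm z * norm (catalan_gf z) \<le> 1/4 * 2"
    using assms norm_catalan_gf_le[OF assms] by (intro mult_mono) auto
  then have "norm (2 * z * catalan_gf z) \<le> 1"
    by (simp add: norm_mult)
  then have nonneg: "Re s \<ge> 0"
    using complex_Re_le_cmod[of "2 * z * catalan_gf z"] unfolding s_def minus_complex.sel by simp
  \<comment> \<open>On the imaginary axis \<open>csqrt_unique\<close> also asks for the sign of
    \<open>Im s\<close>. There the square is at most 0, while 1 - 4z has nonnegative real part, so
    only 0 remains.\<close>
  have "s = 0" if "Re s = 0"
  proof -
    have "Re (s\<^sup>2) = - (Im s)\<^sup>2"
      using that by (simp add: power2_eq_square)
    moreover have "Re (s\<^sup>2) \<ge> 0"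
      using assms complex_Re_le_cmod[of z] by (simp add: sq)
    ultimately show ?thesis
      using that by (simp add: complex_eq_iff)
  qed
  then have "csqrt (1 - 4 * z) = s"
    using nonneg sq by (intro csqrt_unique) fastforce+
  then show ?thesis
    by (simp add: s_def)
qed

subsection \<open>The spectrum\<close>

lemma summable_of_real_mult_power:
  fixes a :: "nat \<Rightarrow> real" and w :: complex
  assumes "\<And>n. a n \<ge> 0" "summable a" "norm w \<le> 1"
  shows "summable (\<lambda>m. of_real (a m) * w ^ m)"
proof (rule summable_comparison_test'[OF assms(2)])
  show "norm (of_real (a m) * w ^ m) \<le> a m" for m
    using assms(1)[of m] power_le_one[of "norm w" m] assms(3)
    by (simp add: norm_mult norm_power mult_left_le)
qed

text \<open>Summation by parts: \<open>(1 - w) \<Sum> a\<^sub>m w\<^sup>m = a\<^sub>0 - \<Sum> (a\<^sub>m - a\<^bsub>m+1\<^esub>) w\<^bsup>m+1\<^esup>\<close>.\<close>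

lemma norm_suminf_decseq_le:
  fixes a :: "nat \<Rightarrow> real" and w :: complex
  assumes "decseq a" "\<And>n. a n \<ge> 0" "summable a" "norm w \<le> 1" "w \<noteq> 1"
  shows "norm (\<Sum>m. of_real (a m) * w ^ m) \<le> 2 * a 0 / norm (1 - w)"
proof -
  note sm = summable_of_real_mult_power[OF assms(2-4)]
  define T where "T = (\<Sum>m. of_real (a m) * w ^ m)"
  have "(\<lambda>m. w * (of_real (a m) * w ^ m)) sums (w * T)"
    unfolding T_def using sm by (intro sums_mult summable_sums)
  moreover have "(\<lambda>m. of_real (a (Suc m)) * w ^ Suc m) sums (T - of_real (a 0))"
    using sums_split_initial_segment[OF summable_sums[OF sm], of 1] by (simp add: T_def)
  ultimately have "(\<lambda>m. w * (of_real (a m) * w ^ m) - of_real (a (Suc m)) * w ^ Suc m)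
      sums (w * T - (T - of_real (a 0)))"
    by (rule sums_diff)
  then have D: "(\<lambda>m. of_real (a m - a (Suc m)) * w ^ Suc m) sums (of_real (a 0) - (1 - w) * T)"
    by (simp add: algebra_simps)
  \<comment> \<open>The differences are nonnegative and telescope to \<open>a 0\<close>, so they
    bound the series in \<open>D\<close>. The triangle inequality then produces the factor
    2.\<close>
  have E: "(\<lambda>m. a m - a (Suc m)) sums (a 0)"
    using telescope_sums'[OF summable_LIMSEQ_zero[OF assms(3)]] by simp
  have "norm (\<Sum>m. of_real (a m - a (Suc m)) * w ^ Suc m) \<le> (\<Sum>m. a m - a (Suc m))"
  proof (rule norm_suminf_le[OF _ sums_summable[OF E]])
    show "norm (of_real (a m - a (Suc m)) * w ^ Suc m) \<le> a m - a (Suc m)" for m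
      using decseqD[OF assms(1), of m "Suc m"] power_le_one[of "norm w" "Suc m"] assms(4)
      by (simp only: norm_mult norm_power norm_of_real) (simp add: mult_left_le)
  qed
  then have "norm (of_real (a 0) - (1 - w) * T) \<le> a 0"
    unfolding sums_unique[OF D, symmetric] sums_unique[OF E, symmetric] .
  moreover have "norm ((1 - w) * T) \<le> norm (of_real (a 0) - (1 - w) * T) + norm (of_real (a 0) :: complex)"
    by (metis add.commute diff_diff_eq2 add_diff_cancel_left' norm_triangle_ineq4 norm_minus_commute)
  ultimately have "norm (1 - w) * norm T \<le> 2 * a 0"
    using assms(2)[of 0] by (simp add: norm_mult)
  then show ?thesis
    using assms(5) unfolding T_def by (simp add: field_simps)
qed

text \<open>The ratio of consecutive Catalan numbers is (4n + 2) / (n + 2), which is at most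
  4.\<close>

lemma decseq_catalan: "decseq (\<lambda>n. norm (catalan n) / 4 ^ n)"
proof (rule decseq_SucI)
  fix n
  have "norm (of_nat (n + 2) * catalan (Suc n)) = norm (of_nat (4 * n + 2) * catalan n)"
    by (simp only: catalan_rec)
  then have "real (n + 2) * norm (catalan (Suc n)) = real (4 * n + 2) * norm (catalan n)"
    by (simp only: norm_mult norm_of_nat)
  also have "\<dots> \<le> real (n + 2) * (4 * norm (catalan n))"
    by (simp add: algebra_simps)
  finally have "norm (catalan (Suc n)) \<le> 4 * norm (catalan n)"
    by (simp only: mult_le_cancel_left_pos of_nat_0_less_iff)
  then show "norm (catalan (Suc n)) / 4 ^ Suc n \<le> norm (catalan n) / 4 ^ n"
    by (simp add: divide_simps)
qed

text \<open>On the circle of radius \<open>1/4\<close> the tails are not absolutely small enough, since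
  \<open>C\<^sub>n / 4\<^sup>n\<close> decays only like \<open>n powr (-3/2)\<close>; the oscillation of \<open>(4 z)\<^sup>n\<close> is needed.\<close>

lemma divided_difference_catalan_in_ell1:
  assumes "norm z \<le> 1/4" "z \<noteq> 1/4"
  shows "(\<lambda>n. \<Sum>m. catalan (Suc n + m) * z ^ m) \<in> ell1"
proof -
  define a where "a = (\<lambda>n. norm (catalan n) / 4 ^ n)"
  have summable: "summable a"
    using catalan_in_ell1 by (simp add: ell1_def a_def)
  have catalan_a: "catalan n = of_real (a n) * 4 ^ n" for n
    unfolding a_def catalan_def norm_divide norm_of_nat by simp
  have "4 * z \<noteq> 1"
    using assms(2) by (metis nonzero_mult_div_cancel_left zero_neq_numeral)
  have nonneg: "a n \<ge> 0" for n
    by (simp add: a_def)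
  have tail: "summable (\<lambda>m. a (Suc n + m))" for n
    using summable_ignore_initial_segment[OF summable, of "Suc n"] by (simp add: add.commute)
  \<comment> \<open>The 8 is the 2 of \<open>norm_suminf_decseq_le\<close> times the quotient 4 of
    \<open>4 ^ Suc n\<close> and \<open>4 ^ n\<close>.\<close>
  have bound: "norm (\<Sum>m. catalan (Suc n + m) * z ^ m) / 4 ^ n \<le> 8 / norm (1 - 4 * z) * a (Suc n)" for n
  proof -
    have "norm (\<Sum>m. of_real (a (Suc n + m)) * (4 * z) ^ m) \<le> 2 * a (Suc n + 0) / norm (1 - 4 * z)"
    proof (rule norm_suminf_decseq_le)
      show "decseq (\<lambda>m. a (Suc n + m))"
        using decseq_catalan unfolding a_def[symmetric] decseq_def by simp
    qed (use assms(1) \<open>4 * z \<noteq> 1\<close> in \<open>auto simp: nonneg tail[simplified] norm_mult\<close>)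
    moreover have "(\<Sum>m. catalan (Suc n + m) * z ^ m)
        = 4 ^ Suc n * (\<Sum>m. of_real (a (Suc n + m)) * (4 * z) ^ m)"
    proof -
      have "summable (\<lambda>m. of_real (a (Suc n + m)) * (4 * z) ^ m)"
        by (rule summable_of_real_mult_power[OF nonneg tail]) (use assms(1) in \<open>simp add: norm_mult\<close>)
      from suminf_mult[OF this, symmetric] show ?thesis
        unfolding catalan_a by (simp add: power_add power_mult_distrib mult_ac)
    qed
    ultimately show ?thesis
      by (simp add: norm_mult norm_power)
  qed
  show ?thesis
    unfolding ell1_def mem_Collect_eq
  proof (rule summable_comparison_test')
    show "summable (\<lambda>n. 8 / norm (1 - 4 * z) * a (Suc n))"
      using summable by (intro summable_mult) (simp add: summable_Suc_iff)
  qed (use bound in simp)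
qed

section \<open>Characters and resolvents\<close>

lemma ell1_spectrum_fps:
  "l \<in> ell1_spectrum (fps_nth f) \<longleftrightarrow> \<not> (\<exists>g. fps_nth g \<in> ell1 \<and> (fps_const l - f) * g = 1)"
proof -
  have "(\<lambda>n. l * delta0 n - fps_nth f n) = fps_nth (fps_const l - f)"
    by (auto simp: delta0_def)
  then show ?thesis
    by (simp add: ell1_spectrum_def ell1_invertible_iff_fps)
qed

text \<open>Evaluating at z sends l - f to 0 and a product equal to 1 to 1, so no inverse can
  exist.\<close>

lemma eval_fps_in_ell1_spectrum:
  assumes "fps_nth f \<in> ell1" "norm z \<le> 1/4"
  shows "eval_fps f z \<in> ell1_spectrum (fps_nth f)"
  unfolding ell1_spectrum_fps
proof clarify
  fix g
  define l where "l = eval_fps f z"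
  assume g: "fps_nth g \<in> ell1" and "(fps_const (eval_fps f z) - f) * g = 1"
  then have "fps_const l * g = 1 + f * g"
    by (simp add: algebra_simps l_def)
  then have "eval_fps (fps_const l * g) z = eval_fps (1 + f * g) z"
    by simp
  then have "l * eval_fps g z = 1 + l * eval_fps g z"
    using assms g
    by (simp add: eval_fps_mult_ell1 eval_fps_add_ell1 ell1_fps_const ell1_fps_mult
          ell1_fps_const[of 1, simplified] l_def)
  then show False
    by simp
qed

text \<open>Subtracting the quadratic equations gives
  \<open>(l - C) (X (l + C) - 1) = l\<^sup>2 X - l + 1 = l\<^sup>2 (X - z)\<close> with \<open>z = (l - 1) / l\<^sup>2\<close>, so the inverse of
  \<open>l - C\<close> is \<open>(X (l + C) - 1) / (l\<^sup>2 (X - z))\<close>. If \<open>z\<close> is in the disc, then \<open>l\<close> and \<open>C(z)\<close> are the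
  two roots of the quadratic at \<open>z\<close>, and the numerator is \<open>X (C - C(z)) + (X - z) / z\<close>.\<close>

lemma catalan_resolvent:
  assumes "l \<notin> catalan_gf ` cball 0 (1/4)"
  shows "\<exists>g. fps_nth g \<in> ell1 \<and> (fps_const l - catalan_fps) * g = 1"
proof -
  let ?C = catalan_fps
  note mem = ell1_fps_add ell1_fps_mult ell1_fps_const ell1_fps_X catalan_fps_in_ell1
  define N where "N = fps_X * (fps_const l + ?C) + fps_const (- 1)"
  have N: "fps_nth N \<in> ell1"
    unfolding N_def by (intro mem)
  have N_eq: "N = fps_X * (fps_const l + ?C) - 1"
    by (simp add: N_def fps_const_neg[symmetric] del: fps_const_neg)
  have num: "(fps_const l - ?C) * N = fps_X * fps_const l * fps_const l - fps_const l + 1"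
    using catalan_fps_quadratic unfolding N_eq by algebra
  show ?thesis
  proof (cases "l = 0")
    \<comment> \<open>Here \<open>z\<close> would be a division by zero, but \<open>num\<close>
      already says that \<open>N\<close> is the inverse.\<close>
    case True
    with num N show ?thesis
      by auto
  next
    case False
    define z where "z = (l - 1) / l\<^sup>2"
    have lz: "l\<^sup>2 * z = l - 1"
      using False by (simp add: z_def)
    have num': "(fps_const l - ?C) * N = fps_const (l\<^sup>2) * (fps_X - fps_const z)"
    proof -
      have "fps_const (l\<^sup>2) * fps_const z = fps_const l - 1"
        using lz by (simp add: fps_const_sub[symmetric] del: fps_const_sub)
      then show ?thesis
        unfolding num by (simp add: right_diff_distrib power2_eq_square fps_const_mult[symmetric] mult_ac
            del: fps_const_mult)
    qed
    have "\<exists>h. fps_nth h \<in> ell1 \<and> N = (fps_X - fps_const z) * h"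
    proof (cases "norm z \<le> 1/4")
      case False
      then have "z \<noteq> 0"
        by auto
      then have "(fps_X - fps_const z) * inverse (fps_X - fps_const z) = 1"
        by (intro inverse_mult_eq_1') simp
      then have "N = (fps_X - fps_const z) * (inverse (fps_X - fps_const z) * N)"
        by (simp add: mult.assoc[symmetric])
      then show ?thesis
        using False ell1_inverse_linear[of z] N ell1_fps_mult by (meson not_le)
    next
      case True
      define m where "m = catalan_gf z"
      have "l \<noteq> m"
        using assms True unfolding m_def by auto
      moreover have "z * m\<^sup>2 = m - 1"
        unfolding m_def using catalan_gf_quadratic[OF True] by (metis add_diff_cancel_left')
      \<comment> \<open>Both l and m solve the quadratic at z. They differ because l is not a value
        of \<open>catalan_gf\<close>, and Vieta's formula gives the sum of the roots.\<close>
      then have "(l - m) * (z * (l + m) - 1) = 0"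
        using lz by algebra
      ultimately have sum: "z * (l + m) = 1"
        by simp
      then have z0: "z \<noteq> 0"
        by auto
      have "z \<noteq> 1/4"
      proof
        assume z: "z = 1/4"
        have "(l - 2)\<^sup>2 = 0" "(m - 2)\<^sup>2 = 0"
          using lz \<open>z * m\<^sup>2 = m - 1\<close> unfolding z by (simp_all add: field_simps power2_eq_square)
        then show False
          using \<open>l \<noteq> m\<close> by simp
      qed
      define G where "G = Abs_fps (\<lambda>n. \<Sum>k. catalan (Suc n + k) * z ^ k)"
      have G: "fps_nth G \<in> ell1"
        using divided_difference_catalan_in_ell1[OF True \<open>z \<noteq> 1/4\<close>] by (simp add: G_def Abs_fps_inverse)
      have "(fps_X - fps_const z) * G = ?C - fps_const m"
        using divided_difference_fps[OF catalan_fps_in_ell1 True]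
        by (simp add: G_def m_def catalan_gf_eq_eval catalan_fps_def)
      moreover have "fps_const z * fps_const (1 / z) = 1"
        using z0 by simp
      moreover have "fps_const l + fps_const m = fps_const (1 / z)"
        using sum z0 by (simp add: field_simps)
      ultimately have "N = (fps_X - fps_const z) * (fps_X * G + fps_const (1 / z))"
        unfolding N_eq by algebra
      moreover have "fps_nth (fps_X * G + fps_const (1 / z)) \<in> ell1"
        by (intro mem G)
      ultimately show ?thesis
        by blast
    qed
    then obtain h where h: "fps_nth h \<in> ell1" "N = (fps_X - fps_const z) * h"
      by blast
    \<comment> \<open>The linear factor is cancelled among all formal series: for z in the disc it
      has no inverse in the algebra.\<close>
    have "(fps_X - fps_const z) * ((fps_const l - ?C) * h) = (fps_X - fps_const z) * fps_const (l\<^sup>2)"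
      using num' unfolding h(2) by (simp add: mult_ac)
    moreover have "fps_X - fps_const z \<noteq> 0"
    proof
      assume "fps_X - fps_const z = 0"
      then have "fps_nth (fps_X - fps_const z) 1 = 0"
        by simp
      then show False
        by simp
    qed
    ultimately have "(fps_const l - ?C) * h = fps_const (l\<^sup>2)"
      by simp
    moreover have "fps_const (l\<^sup>2) * fps_const (1 / l\<^sup>2) = 1"
      using False by simp
    ultimately have "(fps_const l - ?C) * (h * fps_const (1 / l\<^sup>2)) = 1"
      by (simp only: mult.assoc[symmetric])
    then show ?thesis
      using h(1) ell1_fps_mult ell1_fps_const by blast
  qed
qed

lemma ell1_spectrum_catalan: "ell1_spectrum catalan = catalan_gf ` cball 0 (1/4)"
proof
  show "ell1_spectrum catalan \<subseteq> catalan_gf ` cball 0 (1/4)"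
    using catalan_resolvent ell1_spectrum_fps[of _ catalan_fps]
    unfolding fps_nth_catalan_fps by blast
  show "catalan_gf ` cball 0 (1/4) \<subseteq> ell1_spectrum catalan"
    using eval_fps_in_ell1_spectrum[OF catalan_fps_in_ell1]
    by (auto simp: catalan_gf_eq_eval fps_nth_catalan_fps)
qed

subsection \<open>The boundary\<close>

lemma frontier_catalan_gf_cball:
  "frontier (catalan_gf ` cball 0 (1/4)) = catalan_gf ` sphere 0 (1/4)"
proof -
  let ?K = "catalan_gf ` cball 0 (1/4)"
  let ?g = "\<lambda>w::complex. (w - 1) / w\<^sup>2"
  have "compact ?K"
    by (intro compact_continuous_image continuous_on_catalan_gf) simp
  then have closed: "closed ?K"
    by (rule compact_imp_closed)
  have "open (catalan_gf ` ball 0 (1/4))"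
  proof (rule open_mapping_thm3)
    show "catalan_gf holomorphic_on ball 0 (1/4)"
      by (rule power_series_holomorphic[where a = catalan])
        (auto simp: catalan_gf_def intro!: summable_sums summable_norm_cancel[OF summable_catalan_gf])
    show "inj_on catalan_gf (ball 0 (1/4))"
      by (rule inj_on_subset[OF inj_on_catalan_gf]) auto
  qed simp
  then have "catalan_gf ` ball 0 (1/4) \<subseteq> interior ?K"
    by (intro interior_maximal image_mono) auto
  moreover have "interior ?K \<subseteq> catalan_gf ` ball 0 (1/4)"
  proof -
    have g: "?g (catalan_gf z) = z" if "z \<in> cball 0 (1/4)" for z
      using catalan_gf_inverse[of z] that by simp
    have int: "interior ?K \<subseteq> ?K"
      by (rule interior_subset)
    have "open (?g ` interior ?K)"
    proof (rule open_mapping_thm3)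
      have "0 \<notin> ?K"
        using catalan_gf_nonzero by fastforce
      then show "?g holomorphic_on interior ?K"
        using int by (intro holomorphic_intros) auto
      show "inj_on ?g (interior ?K)"
        by (rule inj_on_subset[OF _ int]) (rule inj_on_inverseI[where g = catalan_gf], use g in auto)
    qed simp
    moreover have "?g ` interior ?K \<subseteq> cball 0 (1/4)"
      using int g by fastforce
    \<comment> \<open>An open subset of the closed disc lies in its interior, so no interior point
      of the image comes from the circle.\<close>
    ultimately have "?g ` interior ?K \<subseteq> ball 0 (1/4)"
      using interior_maximal interior_cball by metis
    show ?thesis
    proof
      fix w
      assume w: "w \<in> interior ?K"
      then obtain z where z: "z \<in> cball 0 (1/4)" "w = catalan_gf z"
        using int by auto
      have "?g w \<in> ball 0 (1/4)"
        using w \<open>?g ` interior ?K \<subseteq> ball 0 (1/4)\<close> by blast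
      then show "w \<in> catalan_gf ` ball 0 (1/4)"
        using g[OF z(1)] z(2) by auto
    qed
  qed
  ultimately have "interior ?K = catalan_gf ` ball 0 (1/4)"
    by blast
  then have "frontier ?K = ?K - catalan_gf ` ball 0 (1/4)"
    using closed by (simp add: frontier_def)
  also have "\<dots> = catalan_gf ` (cball 0 (1/4) - ball 0 (1/4))"
    by (rule inj_on_image_set_diff[OF inj_on_catalan_gf, symmetric]) auto
  also have "cball 0 (1/4) - ball 0 (1/4) = sphere (0::complex) (1/4)"
    by auto
  finally show ?thesis .
qed

section \<open>The circle and the principal square root\<close>

lemma sphere_0_eq_exp_image:
  assumes "r \<ge> 0"
  shows "sphere 0 r = (\<lambda>t. of_real r * exp (\<i> * of_real t)) ` {0..<2 * pi}"
proof
  show "sphere 0 r \<subseteq> (\<lambda>t. of_real r * exp (\<i> * of_real t)) ` {0..<2 * pi}"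
  proof
    fix z :: complex
    assume "z \<in> sphere 0 r"
    then show "z \<in> (\<lambda>t. of_real r * exp (\<i> * of_real t)) ` {0..<2 * pi}"
      using Arg2pi_eq[of z] Arg2pi[of z] by (intro image_eqI[of _ _ "Arg2pi z"]) auto
  qed
qed (use assms in \<open>auto simp: norm_mult\<close>)

text \<open>The half-angle formulas give 1 - e^(it) = 2 sin(t/2) e^(-i(pi-t)/2). The range of t
  makes the sine nonnegative and puts (pi-t)/4 in (-pi/4, pi/4], which selects the principal root.
  For t in (-2 pi, 0) the right-hand side would square to the negative of 1 - e^(it).\<close>

lemma csqrt_one_minus_exp:
  assumes "t \<in> {0..<2 * pi}"
  shows "csqrt (1 - exp (\<i> * of_real t))
       = of_real (sqrt (2 * \<bar>sin (t / 2)\<bar>)) * exp (- \<i> * of_real ((pi - t) / 4))"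
    (is "_ = ?r")
proof (rule csqrt_unique)
  have sin: "sin (t / 2) \<ge> 0"
    using assms by (intro sin_ge_zero) auto
  have "?r\<^sup>2 = of_real (2 * sin (t / 2)) * exp (- \<i> * of_real ((pi - t) / 2))"
    unfolding power_mult_distrib of_real_power[symmetric] exp_double[symmetric]
    using sin by simp
  also have "\<dots> = 1 - exp (\<i> * of_real t)"
  proof -
    have "exp (- \<i> * of_real ((pi - t) / 2)) = cis (t / 2 - pi / 2)"
      by (simp add: cis_conv_exp field_simps)
    also have "\<dots> = - \<i> * cis (t / 2)"
      by (simp add: complex_eq_iff cos_diff sin_diff)
    finally have *: "exp (- \<i> * of_real ((pi - t) / 2)) = - \<i> * cis (t / 2)" .
    have "cos t = 1 - 2 * (sin (t / 2))\<^sup>2" "sin t = 2 * sin (t / 2) * cos (t / 2)"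
      using cos_double_sin[of "t / 2"] sin_double[of "t / 2"] by simp_all
    then show ?thesis
      unfolding * cis_conv_exp[symmetric] by (simp add: complex_eq_iff power2_eq_square)
  qed
  finally show "?r\<^sup>2 = 1 - exp (\<i> * of_real t)" .
  have "cos ((pi - t) / 4) > 0"
    using assms by (intro cos_gt_zero_pi) auto
  moreover have "exp (- \<i> * of_real ((pi - t) / 4)) = cis (- ((pi - t) / 4))"
    by (simp add: cis_conv_exp)
  \<comment> \<open>The sine vanishes only at t = 0, where the root itself is 0.\<close>
  ultimately show "0 < Re ?r \<or> Re ?r = 0 \<and> 0 \<le> Im ?r"
    by (cases "sin (t / 2) = 0") auto
qed

text \<open>On the circle, 1 / (2z) = 2 e^(-it), so the closed form from
  \<open>catalan_gf_csqrt\<close> can be solved for the value.\<close>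

lemma catalan_gf_circle:
  assumes "t \<in> {0..<2 * pi}"
  shows "catalan_gf (of_real (1/4) * exp (\<i> * of_real t)) = 2 * exp (- \<i> * of_real t) *
    (1 - of_real (sqrt (2 * \<bar>sin (t / 2)\<bar>)) * exp (- \<i> * of_real ((pi - t) / 4)))"
proof -
  define z where "z = of_real (1/4) * exp (\<i> * of_real t)"
  have "norm z \<le> 1/4"
    by (simp add: z_def norm_mult)
  then have "2 * z * catalan_gf z = 1 - csqrt (1 - 4 * z)"
    by (rule catalan_gf_csqrt)
  moreover have "2 * exp (- \<i> * of_real t) * (2 * z) = 1"
    by (simp add: z_def exp_minus)
  ultimately have "catalan_gf z = 2 * exp (- \<i> * of_real t) * (1 - csqrt (1 - 4 * z))"
    by (metis mult.assoc mult.left_neutral)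
  moreover have "1 - 4 * z = 1 - exp (\<i> * of_real t)"
    by (simp add: z_def)
  ultimately show ?thesis
    unfolding csqrt_one_minus_exp[OF assms, symmetric] z_def by simp
qed

theorem proposition3p2:
  shows "ell1_spectrum catalan = catalan_gf ` closure (ball 0 (1/4))
    \<and> frontier (ell1_spectrum catalan) =
        {2 * exp (- \<i> * of_real \<theta>) *
           (1 - of_real (sqrt (2 * \<bar>sin (\<theta> / 2)\<bar>)) * exp (- \<i> * of_real ((pi - \<theta>) / 4)))
         | \<theta> :: real. \<theta> \<in> {0..<2 * pi}}"
proof
  show "ell1_spectrum catalan = catalan_gf ` closure (ball 0 (1/4))"
    by (simp add: ell1_spectrum_catalan)
  have "frontier (ell1_spectrum catalan)
      = (\<lambda>t. catalan_gf (of_real (1/4) * exp (\<i> * of_real t))) ` {0..<2 * pi}"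
    unfolding ell1_spectrum_catalan frontier_catalan_gf_cball
    by (subst sphere_0_eq_exp_image) (simp_all add: image_image)
  also have "\<dots> = (\<lambda>\<theta>. 2 * exp (- \<i> * of_real \<theta>) *
      (1 - of_real (sqrt (2 * \<bar>sin (\<theta> / 2)\<bar>)) * exp (- \<i> * of_real ((pi - \<theta>) / 4)))) ` {0..<2 * pi}"
    by (intro image_cong refl catalan_gf_circle)
  finally show "frontier (ell1_spectrum catalan) =
        {2 * exp (- \<i> * of_real \<theta>) *
           (1 - of_real (sqrt (2 * \<bar>sin (\<theta> / 2)\<bar>)) * exp (- \<i> * of_real ((pi - \<theta>) / 4)))
         | \<theta> :: real. \<theta> \<in> {0..<2 * pi}}"
    by (simp only: image_def Setcompr_eq_image)
qed

end
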